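(* The group $\mathrm{QI}^{+}(\mathbb{R})$ is left-orderable, and the group $\mathrm{QI}([0,+\infty))$ is left-orderable.
   Context: A function $f:X\to Y$ between metric spaces is a quasi-isometry if there exist real numbers $K\ge 1$, $C\ge 0$ such that $\frac1K d(x_1,x_2)-C\le d(f(x_1),f(x_2))\le K d(x_1,x_2)+C$ for all $x_1,x_2\in X$, and $d(\mathrm{Im} f,y)\le C$ for every $y\in Y$. Two quasi-isometries $f,g$ are equivalent if $\sup_{x\in X}d(f(x),g(x))<\infty$. The quasi-isometry group $\mathrm{QI}(X)$ is the group of equivalence classes $[f]$ of quasi-isometries $f:X\to X$ under composition. The real line $\mathbb{R}$ and the ray $[0,+\infty)$ carry the usual metric. $\mathrm{QI}^{+}(\mathbb{R})\le \mathrm{QI}(\mathbb{R})$ is the orientation-preserving subgroup: the classes $[f]$ with $f(x)\to+\infty$ as $x\to+\infty$ and $f(x)\to-\infty$ as $x\to-\infty$ (equivalently, the classes represented by increasing homeomorphisms of $\mathbb{R}$ that are quasi-isometries). A group $G$ is left-orderable if there is a total order $\le$ on $G$ such that $g\le h$ implies $fg\le fh$ for all $f\in G$. *)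

theory Defs
  imports "HOL-Analysis.Analysis" "HOL-Algebra.Group"
begin

text \<open>
  Metric spaces are subsets \<open>X\<close>, \<open>Y\<close> of metric type-class types, with the induced metric.
\<close>

text \<open>
  The same \<open>C\<close> occurs in both conditions, the second one being \<open>d(Im f, y) \<le> C\<close>. As the library
  sets \<^term>\<open>infdist y {}\<close> to \<open>0\<close> rather than to infinity, an empty image has to be
  excluded separately when \<open>Y\<close> is nonempty.
\<close>

definition quasi_isometry_on ::
    "'a::metric_space set \<Rightarrow> 'b::metric_space set \<Rightarrow> ('a \<Rightarrow> 'b) \<Rightarrow> bool" where
  "quasi_isometry_on X Y f \<longleftrightarrow>
     f \<in> X \<rightarrow> Y \<and> (X = {} \<longrightarrow> Y = {}) \<and>
     (\<exists>K C. K \<ge> 1 \<and> C \<ge> 0 \<and>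
        (\<forall>x1\<in>X. \<forall>x2\<in>X.
            1 / K * dist x1 x2 - C \<le> dist (f x1) (f x2) \<and>
            dist (f x1) (f x2) \<le> K * dist x1 x2 + C) \<and>
        (\<forall>y\<in>Y. infdist y (f ` X) \<le> C))"

definition quasi_isometries :: "'a::metric_space set \<Rightarrow> ('a \<Rightarrow> 'a) set" where
  "quasi_isometries X = {f. quasi_isometry_on X X f}"

text \<open>
  Functions are total on the type; the relation only looks at their values on \<open>X\<close>, so functions
  agreeing on \<open>X\<close> are identified in the quotient.
\<close>

definition qi_rel :: "'a::metric_space set \<Rightarrow> (('a \<Rightarrow> 'a) \<times> ('a \<Rightarrow> 'a)) set" where
  "qi_rel X = {(f, g). f \<in> quasi_isometries X \<and> g \<in> quasi_isometries X \<and>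
                       bdd_above ((\<lambda>x. dist (f x) (g x)) ` X)}"

definition qi_class :: "'a::metric_space set \<Rightarrow> ('a \<Rightarrow> 'a) \<Rightarrow> ('a \<Rightarrow> 'a) set" where
  "qi_class X f = qi_rel X `` {f}"

text \<open>
  The product is composition lifted to classes; the union over all representatives is
  \<open>[f \<circ> g]\<close> because composition respects the relation (lemma \<open>QI_mult_class\<close> below).
\<close>

definition QI :: "'a::metric_space set \<Rightarrow> ('a \<Rightarrow> 'a) set monoid" where
  "QI X = \<lparr>carrier = quasi_isometries X // qi_rel X,
           monoid.mult = (\<lambda>A B. \<Union>f\<in>A. \<Union>g\<in>B. qi_class X (f \<circ> g)),
           one = qi_class X id\<rparr>"

definition orientation_preserving :: "(real \<Rightarrow> real) \<Rightarrow> bool" where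
  "orientation_preserving f \<longleftrightarrow> filterlim f at_top at_top \<and> filterlim f at_bot at_bot"

definition QI_plus :: "(real \<Rightarrow> real) set monoid" where
  "QI_plus = (QI (UNIV :: real set))
     \<lparr>carrier := {qi_class UNIV f | f. f \<in> quasi_isometries UNIV \<and> orientation_preserving f}\<rparr>"

definition left_orderable :: "('a, 'b) monoid_scheme \<Rightarrow> bool" where
  "left_orderable G \<longleftrightarrow>
     group G \<and>
     (\<exists>R. linear_order_on (carrier G) R \<and>
          (\<forall>f\<in>carrier G. \<forall>g\<in>carrier G. \<forall>h\<in>carrier G.
              (g, h) \<in> R \<longrightarrow> (f \<otimes>\<^bsub>G\<^esub> g, f \<otimes>\<^bsub>G\<^esub> h) \<in> R))"


lemma quasi_isometry_onE:
  assumes "quasi_isometry_on X Y f"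
  obtains K C where "K \<ge> 1" "C \<ge> 0" "f \<in> X \<rightarrow> Y"
    "\<And>x1 x2. x1 \<in> X \<Longrightarrow> x2 \<in> X \<Longrightarrow> dist x1 x2 \<le> K * dist (f x1) (f x2) + C"
    "\<And>x1 x2. x1 \<in> X \<Longrightarrow> x2 \<in> X \<Longrightarrow> dist (f x1) (f x2) \<le> K * dist x1 x2 + C"
    "\<And>y. y \<in> Y \<Longrightarrow> \<exists>x\<in>X. dist (f x) y \<le> C"
proof -
  from assms obtain K C where KC: "K \<ge> 1" "C \<ge> 0"
    and lo: "\<And>x1 x2. x1 \<in> X \<Longrightarrow> x2 \<in> X \<Longrightarrow> 1 / K * dist x1 x2 - C \<le> dist (f x1) (f x2)"
    and hi: "\<And>x1 x2. x1 \<in> X \<Longrightarrow> x2 \<in> X \<Longrightarrow> dist (f x1) (f x2) \<le> K * dist x1 x2 + C"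
    and su: "\<And>y. y \<in> Y \<Longrightarrow> infdist y (f ` X) \<le> C"
    unfolding quasi_isometry_on_def by blast
  have f: "f \<in> X \<rightarrow> Y" and ne: "X = {} \<Longrightarrow> Y = {}"
    using assms unfolding quasi_isometry_on_def by auto
  define C' where "C' = K * C + C + 1"
  have KCn: "K * C \<ge> 0" using KC by simp
  show ?thesis
  proof (rule that[of K C'])
    show "K \<ge> 1" "C' \<ge> 0" "f \<in> X \<rightarrow> Y" using KC KCn f by (auto simp: C'_def)
  next
    fix x1 x2 assume x: "x1 \<in> X" "x2 \<in> X"
    have "K * (1 / K * dist x1 x2 - C) \<le> K * dist (f x1) (f x2)"
      using lo[OF x] KC by (intro mult_left_mono) auto
    then have "dist x1 x2 - K * C \<le> K * dist (f x1) (f x2)"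
      using KC by (simp add: right_diff_distrib)
    then show "dist x1 x2 \<le> K * dist (f x1) (f x2) + C'" using KC by (simp add: C'_def)
    show "dist (f x1) (f x2) \<le> K * dist x1 x2 + C'"
      using hi[OF x] KC(2) KCn unfolding C'_def by linarith
  next
    fix y assume y: "y \<in> Y"
    then have X: "f ` X \<noteq> {}" using ne by auto
    have "(INF a\<in>f ` X. dist y a) < C'"
      using su[OF y] X KCn by (simp add: infdist_notempty C'_def)
    then obtain a where "a \<in> f ` X" "dist y a < C'"
      using X by (subst (asm) cINF_less_iff) (auto intro!: bdd_belowI2[where m=0])
    then show "\<exists>x\<in>X. dist (f x) y \<le> C'" by (auto simp: dist_commute intro!: bexI less_imp_le)
  qed
qed

lemma quasi_isometry_onI:
  assumes KC: "K \<ge> 1" "C \<ge> 0" and f: "f \<in> X \<rightarrow> Y"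
    and lo: "\<And>x1 x2. x1 \<in> X \<Longrightarrow> x2 \<in> X \<Longrightarrow> dist x1 x2 \<le> K * dist (f x1) (f x2) + C"
    and hi: "\<And>x1 x2. x1 \<in> X \<Longrightarrow> x2 \<in> X \<Longrightarrow> dist (f x1) (f x2) \<le> K * dist x1 x2 + C"
    and su: "\<And>y. y \<in> Y \<Longrightarrow> \<exists>x\<in>X. dist (f x) y \<le> C"
  shows "quasi_isometry_on X Y f"
  unfolding quasi_isometry_on_def
proof (intro conjI exI ballI)
  show "f \<in> X \<rightarrow> Y" "K \<ge> 1" "C \<ge> 0" by fact+
  show "X = {} \<longrightarrow> Y = {}" using su by auto
  fix x1 x2 assume x: "x1 \<in> X" "x2 \<in> X"
  have "1 / K * dist x1 x2 \<le> 1 / K * (K * dist (f x1) (f x2) + C)"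
    using lo[OF x] KC by (intro mult_left_mono) auto
  also have "\<dots> = dist (f x1) (f x2) + C / K" using KC by (simp add: field_simps)
  also have "C / K \<le> C"
  proof -
    have "C * 1 \<le> C * K" using KC by (intro mult_left_mono) auto
    then show ?thesis using KC by (simp add: field_simps)
  qed
  finally show "1 / K * dist x1 x2 - C \<le> dist (f x1) (f x2)" by simp
  show "dist (f x1) (f x2) \<le> K * dist x1 x2 + C" by (rule hi[OF x])
next
  fix y assume "y \<in> Y"
  then obtain x where "x \<in> X" "dist (f x) y \<le> C" using su by auto
  then show "infdist y (f ` X) \<le> C"
    by (intro infdist_le2[of "f x"]) (auto simp: dist_commute)
qed

lemma quasi_isometry_on_id: "quasi_isometry_on X X id"
  by (rule quasi_isometry_onI[of 1 0]) (auto intro: bexI)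

lemma quasi_isometry_on_comp:
  assumes "quasi_isometry_on X Y f" "quasi_isometry_on Y Z g"
  shows "quasi_isometry_on X Z (g \<circ> f)"
proof -
  obtain K C where f: "K \<ge> 1" "C \<ge> 0" "f \<in> X \<rightarrow> Y"
    "\<And>x1 x2. x1 \<in> X \<Longrightarrow> x2 \<in> X \<Longrightarrow> dist x1 x2 \<le> K * dist (f x1) (f x2) + C"
    "\<And>x1 x2. x1 \<in> X \<Longrightarrow> x2 \<in> X \<Longrightarrow> dist (f x1) (f x2) \<le> K * dist x1 x2 + C"
    "\<And>y. y \<in> Y \<Longrightarrow> \<exists>x\<in>X. dist (f x) y \<le> C"
    using quasi_isometry_onE[OF assms(1)] by metis
  obtain L D where g: "L \<ge> 1" "D \<ge> 0" "g \<in> Y \<rightarrow> Z"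
    "\<And>x1 x2. x1 \<in> Y \<Longrightarrow> x2 \<in> Y \<Longrightarrow> dist x1 x2 \<le> L * dist (g x1) (g x2) + D"
    "\<And>x1 x2. x1 \<in> Y \<Longrightarrow> x2 \<in> Y \<Longrightarrow> dist (g x1) (g x2) \<le> L * dist x1 x2 + D"
    "\<And>y. y \<in> Z \<Longrightarrow> \<exists>x\<in>Y. dist (g x) y \<le> D"
    using quasi_isometry_onE[OF assms(2)] by metis
  have nn: "K * D \<ge> 0" "L * C \<ge> 0" using f(1,2) g(1,2) by auto
  show ?thesis
  proof (rule quasi_isometry_onI[of "K * L" "K * D + L * C + C + D"])
    have "1 * 1 \<le> K * L" using f(1) g(1) by (intro mult_mono) auto
    then show "1 \<le> K * L" by simp
    show "0 \<le> K * D + L * C + C + D" using nn f g by simp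
    show "g \<circ> f \<in> X \<rightarrow> Z" using f(3) g(3) by auto
  next
    fix x1 x2 assume x: "x1 \<in> X" "x2 \<in> X"
    then have y: "f x1 \<in> Y" "f x2 \<in> Y" using f(3) by auto
    have "K * dist (f x1) (f x2) \<le> K * (L * dist (g (f x1)) (g (f x2)) + D)"
      using g(4)[OF y] f(1) by (intro mult_left_mono) auto
    then show "dist x1 x2 \<le> K * L * dist ((g \<circ> f) x1) ((g \<circ> f) x2) + (K * D + L * C + C + D)"
      using f(4)[OF x] nn f(2) g(2) by (simp add: algebra_simps)
    have "L * dist (f x1) (f x2) \<le> L * (K * dist x1 x2 + C)"
      using f(5)[OF x] g(1) by (intro mult_left_mono) auto
    then show "dist ((g \<circ> f) x1) ((g \<circ> f) x2) \<le> K * L * dist x1 x2 + (K * D + L * C + C + D)"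
      using g(5)[OF y] nn f(2) g(2) by (simp add: algebra_simps)
  next
    fix z assume "z \<in> Z"
    then obtain y where y: "y \<in> Y" "dist (g y) z \<le> D" using g(6) by auto
    then obtain x where x: "x \<in> X" "dist (f x) y \<le> C" using f(6) by auto
    have "dist (g (f x)) (g y) \<le> L * dist (f x) y + D" using x y f(3) by (intro g(5)) auto
    also have "L * dist (f x) y \<le> L * C" using x g(1) by (intro mult_left_mono) auto
    finally have "dist (g (f x)) z \<le> L * C + D + D"
      using y(2) dist_triangle[of "g (f x)" z "g y"] by simp
    moreover have "D \<le> K * D" using mult_right_mono[OF f(1) g(2)] by simp
    ultimately have "dist ((g \<circ> f) x) z \<le> K * D + L * C + C + D" using f(2) by simp
    with x(1) show "\<exists>x\<in>X. dist ((g \<circ> f) x) z \<le> K * D + L * C + C + D" by blast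
  qed
qed

lemma qi_relI:
  assumes "f \<in> quasi_isometries X" "g \<in> quasi_isometries X"
    and "\<And>x. x \<in> X \<Longrightarrow> dist (f x) (g x) \<le> B"
  shows "(f, g) \<in> qi_rel X"
  using assms unfolding qi_rel_def by (auto intro!: bdd_aboveI2[where M=B])

lemma qi_relE:
  assumes "(f, g) \<in> qi_rel X"
  obtains B where "f \<in> quasi_isometries X" "g \<in> quasi_isometries X"
    "\<And>x. x \<in> X \<Longrightarrow> dist (f x) (g x) \<le> B"
  using assms unfolding qi_rel_def bdd_above_def by auto

lemma equiv_qi_rel: "equiv (quasi_isometries X) (qi_rel X)"
proof (rule equivI)
  show "qi_rel X \<subseteq> quasi_isometries X \<times> quasi_isometries X"
    unfolding qi_rel_def by auto
  show "refl_on (quasi_isometries X) (qi_rel X)"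
    by (auto simp: refl_on_def intro!: qi_relI[where B=0])
  show "sym (qi_rel X)"
    by (auto simp: sym_def qi_rel_def dist_commute)
  show "trans (qi_rel X)"
  proof (rule transI)
    fix f g h assume "(f, g) \<in> qi_rel X" "(g, h) \<in> qi_rel X"
    then obtain B B' where "f \<in> quasi_isometries X" "h \<in> quasi_isometries X"
      and B: "\<And>x. x \<in> X \<Longrightarrow> dist (f x) (g x) \<le> B" "\<And>x. x \<in> X \<Longrightarrow> dist (g x) (h x) \<le> B'"
      by (elim qi_relE) metis
    moreover have "dist (f x) (h x) \<le> B + B'" if "x \<in> X" for x
      using B[OF that] dist_triangle[of "f x" "h x" "g x"] by simp
    ultimately show "(f, h) \<in> qi_rel X" by (intro qi_relI)
  qed
qed

lemma quasi_isometries_comp: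
  "f \<in> quasi_isometries X \<Longrightarrow> g \<in> quasi_isometries X \<Longrightarrow> f \<circ> g \<in> quasi_isometries X"
  unfolding quasi_isometries_def using quasi_isometry_on_comp by blast

lemma quasi_isometries_id: "id \<in> quasi_isometries X"
  by (simp add: quasi_isometries_def quasi_isometry_on_id)

lemma quasi_isometriesE:
  assumes "f \<in> quasi_isometries X"
  obtains K C where "K \<ge> 1" "C \<ge> 0" "f \<in> X \<rightarrow> X"
    "\<And>x1 x2. x1 \<in> X \<Longrightarrow> x2 \<in> X \<Longrightarrow> dist x1 x2 \<le> K * dist (f x1) (f x2) + C"
    "\<And>x1 x2. x1 \<in> X \<Longrightarrow> x2 \<in> X \<Longrightarrow> dist (f x1) (f x2) \<le> K * dist x1 x2 + C"
    "\<And>y. y \<in> X \<Longrightarrow> \<exists>x\<in>X. dist (f x) y \<le> C"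
  using assms quasi_isometry_onE[of X X f] unfolding quasi_isometries_def by auto

lemma qi_class_eq_iff:
  assumes "f \<in> quasi_isometries X" "g \<in> quasi_isometries X"
  shows "qi_class X f = qi_class X g \<longleftrightarrow> bdd_above ((\<lambda>x. dist (f x) (g x)) ` X)"
  using eq_equiv_class_iff[OF equiv_qi_rel assms] assms
  by (simp add: qi_class_def qi_rel_def)

lemma qi_rel_comp:
  assumes "(f, f') \<in> qi_rel X" "(g, g') \<in> qi_rel X"
  shows "(f \<circ> g, f' \<circ> g') \<in> qi_rel X"
proof -
  obtain B where f: "f \<in> quasi_isometries X" "f' \<in> quasi_isometries X"
    "\<And>x. x \<in> X \<Longrightarrow> dist (f x) (f' x) \<le> B" using assms(1) by (rule qi_relE) auto
  obtain B' where g: "g \<in> quasi_isometries X" "g' \<in> quasi_isometries X"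
    "\<And>x. x \<in> X \<Longrightarrow> dist (g x) (g' x) \<le> B'" using assms(2) by (rule qi_relE) auto
  obtain K C where K: "K \<ge> 1"
    "\<And>x1 x2. x1 \<in> X \<Longrightarrow> x2 \<in> X \<Longrightarrow> dist (f x1) (f x2) \<le> K * dist x1 x2 + C"
    using quasi_isometriesE[OF f(1)] by metis
  have maps: "g \<in> X \<rightarrow> X" "g' \<in> X \<rightarrow> X"
    using g by (auto simp: quasi_isometries_def quasi_isometry_on_def)
  have "dist ((f \<circ> g) x) ((f' \<circ> g') x) \<le> K * B' + C + B" if x: "x \<in> X" for x
  proof -
    have m: "g x \<in> X" "g' x \<in> X" using maps x by auto
    have "K * dist (g x) (g' x) \<le> K * B'" using g(3)[OF x] K(1) by (intro mult_left_mono) auto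
    then have "dist (f (g x)) (f (g' x)) \<le> K * B' + C" using K(2)[OF m] by simp
    then show ?thesis
      using f(3)[OF m(2)] dist_triangle[of "f (g x)" "f' (g' x)" "f (g' x)"] by simp
  qed
  then show ?thesis
    by (intro qi_relI quasi_isometries_comp f(1,2) g(1,2))
qed

lemma QI_mult_class:
  assumes "f \<in> quasi_isometries X" "g \<in> quasi_isometries X"
  shows "qi_class X f \<otimes>\<^bsub>QI X\<^esub> qi_class X g = qi_class X (f \<circ> g)"
proof -
  have "congruent2 (qi_rel X) (qi_rel X) (\<lambda>f g. qi_class X (f \<circ> g))"
    unfolding congruent2_def qi_class_def
    by (auto intro!: equiv_class_eq[OF equiv_qi_rel] qi_rel_comp)
  from UN_equiv_class2[OF equiv_qi_rel equiv_qi_rel this assms]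
  show ?thesis by (simp add: QI_def qi_class_def)
qed

lemma carrier_QI: "carrier (QI X) = qi_class X ` quasi_isometries X"
  by (auto simp: QI_def qi_class_def quotient_def)

lemma one_QI: "\<one>\<^bsub>QI X\<^esub> = qi_class X id"
  by (simp add: QI_def)

lemma quasi_inverse:
  assumes "f \<in> quasi_isometries X"
  obtains g where "g \<in> quasi_isometries X" "(f \<circ> g, id) \<in> qi_rel X" "(g \<circ> f, id) \<in> qi_rel X"
proof -
  obtain K C where f: "K \<ge> 1" "C \<ge> 0" "f \<in> X \<rightarrow> X"
    "\<And>x1 x2. x1 \<in> X \<Longrightarrow> x2 \<in> X \<Longrightarrow> dist x1 x2 \<le> K * dist (f x1) (f x2) + C"
    "\<And>x1 x2. x1 \<in> X \<Longrightarrow> x2 \<in> X \<Longrightarrow> dist (f x1) (f x2) \<le> K * dist x1 x2 + C"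
    "\<And>y. y \<in> X \<Longrightarrow> \<exists>x\<in>X. dist (f x) y \<le> C"
    using quasi_isometriesE[OF assms] by metis
  obtain g where g: "\<And>y. y \<in> X \<Longrightarrow> g y \<in> X" "\<And>y. y \<in> X \<Longrightarrow> dist (f (g y)) y \<le> C"
    using f(6) by metis
  have nn: "0 \<le> K * C" using f by simp
  have gf: "dist (g (f x)) x \<le> K * C + C" if x: "x \<in> X" for x
  proof -
    have fx: "f x \<in> X" using f(3) x by auto
    have "dist (g (f x)) x \<le> K * dist (f (g (f x))) (f x) + C" using g fx x by (intro f(4)) auto
    also have "K * dist (f (g (f x))) (f x) \<le> K * C" using g(2)[OF fx] f by (intro mult_left_mono) auto
    finally show ?thesis by simp
  qed
  have "quasi_isometry_on X X g"
  proof (rule quasi_isometry_onI[of K "2 * K * C + 3 * C"])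
    show "K \<ge> 1" "g \<in> X \<rightarrow> X" using f g by auto
    show "0 \<le> 2 * K * C + 3 * C" using f nn by simp
  next
    fix y1 y2 assume y: "y1 \<in> X" "y2 \<in> X"
    note gy = g(1)[OF y(1)] g(1)[OF y(2)]
    let ?d = "dist (f (g y1)) (f (g y2))"
    have d: "dist y1 y2 \<le> ?d + 2 * C" "?d \<le> dist y1 y2 + 2 * C"
      using g(2)[OF y(1)] g(2)[OF y(2)] dist_triangle[of y1 y2 "f (g y1)"]
        dist_triangle[of "f (g y1)" y2 "f (g y2)"] dist_triangle[of "f (g y1)" "f (g y2)" y1]
        dist_triangle[of y1 "f (g y2)" y2]
      by (simp_all add: dist_commute)
    show "dist y1 y2 \<le> K * dist (g y1) (g y2) + (2 * K * C + 3 * C)"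
      using d(1) f(5)[OF gy] nn by simp
    have "K * ?d \<le> K * (dist y1 y2 + 2 * C)" using d(2) f(1) by (intro mult_left_mono) auto
    then show "dist (g y1) (g y2) \<le> K * dist y1 y2 + (2 * K * C + 3 * C)"
      using f(4)[OF gy] f(2) by (simp add: algebra_simps)
  next
    fix x assume x: "x \<in> X"
    then have "f x \<in> X" using f(3) by auto
    moreover have "dist (g (f x)) x \<le> 2 * K * C + 3 * C" using gf[OF x] nn f(2) by simp
    ultimately show "\<exists>y\<in>X. dist (g y) x \<le> 2 * K * C + 3 * C" by blast
  qed
  then have gQ: "g \<in> quasi_isometries X" by (simp add: quasi_isometries_def)
  show ?thesis
  proof (rule that[OF gQ])
    show "(f \<circ> g, id) \<in> qi_rel X"
      by (rule qi_relI[where B=C]) (simp_all add: quasi_isometries_comp quasi_isometries_id gQ assms g)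
    show "(g \<circ> f, id) \<in> qi_rel X"
      by (rule qi_relI[where B="K * C + C"])
        (simp_all add: quasi_isometries_comp quasi_isometries_id gQ assms gf)
  qed
qed

lemma group_QI: "group (QI X)"
proof (rule groupI)
  fix a assume "a \<in> carrier (QI X)"
  then obtain f where f: "f \<in> quasi_isometries X" "a = qi_class X f" by (auto simp: carrier_QI)
  show "\<one>\<^bsub>QI X\<^esub> \<otimes>\<^bsub>QI X\<^esub> a = a"
    using f by (simp add: one_QI QI_mult_class quasi_isometries_id)
  obtain g where g: "g \<in> quasi_isometries X" "(g \<circ> f, id) \<in> qi_rel X"
    using quasi_inverse[OF f(1)] by blast
  have "qi_class X g \<otimes>\<^bsub>QI X\<^esub> a = \<one>\<^bsub>QI X\<^esub>"
    using f g by (simp add: one_QI QI_mult_class)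
      (simp add: qi_class_def equiv_class_eq[OF equiv_qi_rel])
  with g show "\<exists>b\<in>carrier (QI X). b \<otimes>\<^bsub>QI X\<^esub> a = \<one>\<^bsub>QI X\<^esub>"
    by (auto simp: carrier_QI)
qed (auto simp: carrier_QI one_QI QI_mult_class quasi_isometries_id quasi_isometries_comp comp_assoc)

text \<open>Preserving the orientation does not depend on the representative.\<close>

lemma orientation_preserving_cong:
  assumes "(f, g) \<in> qi_rel UNIV" "orientation_preserving f"
  shows "orientation_preserving g"
proof -
  obtain B where B: "\<And>x. dist (f x) (g x) \<le> B"
    using assms(1) by (rule qi_relE) auto
  have f: "filterlim f at_top at_top" "filterlim f at_bot at_bot"
    using assms(2) by (auto simp: orientation_preserving_def)
  have "filterlim (\<lambda>x. - B + f x) at_top at_top"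
    by (rule filterlim_tendsto_add_at_top[OF tendsto_const f(1)])
  moreover have "- B + f x \<le> g x" for x using B[of x] by (auto simp: dist_real_def)
  ultimately have 1: "filterlim g at_top at_top"
    by (auto intro: filterlim_at_top_mono always_eventually)
  have 2: "filterlim g at_bot at_bot"
    unfolding filterlim_at_bot
  proof
    fix Z
    have "eventually (\<lambda>x. f x \<le> Z - B) at_bot" using f(2) by (auto simp: filterlim_at_bot)
    then show "eventually (\<lambda>x. g x \<le> Z) at_bot"
    proof (rule eventually_mono)
      fix x assume "f x \<le> Z - B"
      then show "g x \<le> Z" using B[of x] by (auto simp: dist_real_def)
    qed
  qed
  from 1 2 show ?thesis by (simp add: orientation_preserving_def)
qed

lemma orientation_preserving_quasi_inverse:
  assumes f: "f \<in> quasi_isometries UNIV" "orientation_preserving f"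
    and fg: "(f \<circ> g, id) \<in> qi_rel UNIV"
  shows "orientation_preserving g"
proof -
  obtain B where B: "\<And>x. dist (f (g x)) x \<le> B"
    using fg by (rule qi_relE) auto
  obtain K C where K: "K \<ge> 1" "\<And>x1 x2. dist (f x1) (f x2) \<le> K * dist x1 x2 + C"
    using quasi_isometriesE[OF f(1)] by (metis UNIV_I)
  have lim: "filterlim f at_top at_top" "filterlim f at_bot at_bot"
    using f(2) by (auto simp: orientation_preserving_def)
  have bd: "\<bar>f x - f N\<bar> \<le> K * (b - a) + C" if "a \<le> x" "x \<le> b" "a \<le> N" "N \<le> b" for x N a b
  proof -
    have "K * dist x N \<le> K * (b - a)" using that K(1) 
      by (intro mult_left_mono) (auto simp: dist_real_def)
    then show ?thesis using K(2)[of x N] by (simp add: dist_real_def)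
  qed
  have 1: "filterlim g at_top at_top"
    unfolding filterlim_at_top
  proof
    fix Z
    obtain N where N: "\<And>x. x \<le> N \<Longrightarrow> f x \<le> 0"
      using lim(2) by (auto simp: filterlim_at_bot eventually_at_bot_linorder)
    define M where "M = max 0 (f Z + (K * (Z - min N Z) + C))"
    have M: "f x \<le> M" if "x \<le> Z" for x
    proof (cases "x \<le> N")
      case True then show ?thesis using N[of x] by (simp add: M_def)
    next
      case False
      then show ?thesis using bd[of "min N Z" x Z Z] that by (auto simp: M_def)
    qed
    have "Z \<le> g x" if "x \<ge> M + B + 1" for x
    proof (rule ccontr)
      assume "\<not> Z \<le> g x"
      then have "f (g x) \<le> M" by (intro M) auto
      then show False using B[of x] that by (auto simp: dist_real_def)
    qed
    then show "eventually (\<lambda>x. Z \<le> g x) at_top"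
      unfolding eventually_at_top_linorder by blast
  qed
  have 2: "filterlim g at_bot at_bot"
    unfolding filterlim_at_bot
  proof
    fix Z
    obtain N where N: "\<And>x. x \<ge> N \<Longrightarrow> f x \<ge> 0"
      using lim(1) by (auto simp: filterlim_at_top eventually_at_top_linorder)
    define M where "M = min 0 (f Z - (K * (max N Z - Z) + C))"
    have M: "f x \<ge> M" if "x \<ge> Z" for x
    proof (cases "x \<ge> N")
      case True then show ?thesis using N[of x] by (simp add: M_def)
    next
      case False
      then show ?thesis using bd[of Z x "max N Z" Z] that by (auto simp: M_def)
    qed
    have "g x \<le> Z" if "x \<le> M - B - 1" for x
    proof (rule ccontr)
      assume "\<not> g x \<le> Z"
      then have "f (g x) \<ge> M" by (intro M) auto
      then show False using B[of x] that by (auto simp: dist_real_def)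
    qed
    then show "eventually (\<lambda>x. g x \<le> Z) at_bot"
      unfolding eventually_at_bot_linorder by blast
  qed
  from 1 2 show ?thesis by (simp add: orientation_preserving_def)
qed

lemma subgroup_QI_plus: "subgroup (carrier QI_plus) (QI UNIV)"
proof -
  interpret group "QI (UNIV :: real set)" by (rule group_QI)
  let ?H = "{qi_class UNIV f | f. f \<in> quasi_isometries UNIV \<and> orientation_preserving f}"
  have "subgroup ?H (QI UNIV)"
  proof (rule subgroupI)
    show "?H \<subseteq> carrier (QI UNIV)" by (auto simp: carrier_QI)
    have "orientation_preserving id"
      by (simp add: orientation_preserving_def filterlim_ident id_def)
    then show "?H \<noteq> {}" using quasi_isometries_id by blast
  next
    fix a assume "a \<in> ?H"
    then obtain f where f: "f \<in> quasi_isometries UNIV" "orientation_preserving f"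
      "a = qi_class UNIV f" by auto
    obtain g where g: "g \<in> quasi_isometries UNIV" "(f \<circ> g, id) \<in> qi_rel UNIV"
      "(g \<circ> f, id) \<in> qi_rel UNIV"
      using quasi_inverse[OF f(1)] by blast
    have "orientation_preserving g"
      by (rule orientation_preserving_quasi_inverse[OF f(1,2) g(2)])
    moreover have "qi_class UNIV g \<otimes>\<^bsub>QI UNIV\<^esub> a = \<one>\<^bsub>QI UNIV\<^esub>"
      using f g by (simp add: one_QI QI_mult_class)
        (simp add: qi_class_def equiv_class_eq[OF equiv_qi_rel])
    then have "inv\<^bsub>QI UNIV\<^esub> a = qi_class UNIV g"
      using f g by (intro inv_equality) (auto simp: carrier_QI)
    ultimately show "inv\<^bsub>QI UNIV\<^esub> a \<in> ?H" using g(1) by blast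
  next
    fix a b assume "a \<in> ?H" "b \<in> ?H"
    then obtain f g where f: "f \<in> quasi_isometries UNIV" "orientation_preserving f"
      "a = qi_class UNIV f" and g: "g \<in> quasi_isometries UNIV" "orientation_preserving g"
      "b = qi_class UNIV g" by auto
    have "orientation_preserving (f \<circ> g)"
      using f(2) g(2) unfolding orientation_preserving_def o_def
      by (auto intro: filterlim_compose)
    then show "a \<otimes>\<^bsub>QI UNIV\<^esub> b \<in> ?H"
      using f g by (auto simp: QI_mult_class intro: quasi_isometries_comp)
  qed
  then show ?thesis by (simp add: QI_plus_def)
qed

lemma group_QI_plus: "group QI_plus"
proof -
  interpret group "QI (UNIV :: real set)" by (rule group_QI)
  have "QI_plus = QI UNIV\<lparr>carrier := carrier QI_plus\<rparr>" by (simp add: QI_plus_def)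
  then show ?thesis using subgroup_imp_group[OF subgroup_QI_plus] by simp
qed

end

theory Submission
  imports Defs
begin

text \<open>
  Let \<open>X\<close> be the line or the ray. An ultrafilter \<open>U\<close> containing \<open>X\<close> decides every comparison between
  two functions, so ``\<open>f \<le> g + B\<close> along \<open>U\<close> for some constant \<open>B\<close>'' is a total preorder on functions,
  and it only depends on the functions up to bounded distance on \<open>X\<close>. It therefore descends to quasi-isometry classes.
  Postcomposition with \<open>h\<close> preserves it as soon as \<open>h\<close> is coarsely increasing, and a quasi-isometry
  of an upward closed subset of the line is coarsely increasing when it tends to \<open>+\<infinity>\<close> at \<open>+\<infinity>\<close>
  (lemma \<open>quasi_isometry_coarsely_increasing\<close>). Both groups consist of classes of such maps: by
  orientation in the case of the line, and because there is only one end in the case of the ray.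

  Hence every ultrafilter gives a left-invariant total preorder on the group. No single one of them
  need be antisymmetric, but together they separate the elements: if \<open>\<bar>f - g\<bar>\<close> is unbounded on \<open>X\<close>, then some
  ultrafilter contains all the sets \<open>{x \<in> X. \<bar>f x - g x\<bar> \<ge> B}\<close>, and along it \<open>f\<close> and \<open>g\<close> are not equivalent
  (lemma \<open>coarse_le_separates\<close>). Comparing two elements by the first ultrafilter that tells them apart,
  in a fixed well-ordering of all ultrafilters, is then a left-invariant total order
  (lemma \<open>left_orderable_lexicographic\<close>).
\<close>

section \<open>Lexicographic combination of left-invariant preorders\<close>

text \<open>
  Well-order the index set and let \<open>g < h\<close> if \<open>g\<close> is strictly below \<open>h\<close> for the first index at which
  the two are not equivalent. Left translations preserve strict comparisons as well, because
  their inverses preserve the weak ones; so they do not change the first such index.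
\<close>

lemma left_orderable_lexicographic:
  fixes G (structure) and le :: "'i \<Rightarrow> 'a \<Rightarrow> 'a \<Rightarrow> bool" and I :: "'i set"
  assumes "group G"
    and total: "\<And>i g h. \<lbrakk>i \<in> I; g \<in> carrier G; h \<in> carrier G\<rbrakk> \<Longrightarrow> le i g h \<or> le i h g"
    and trans: "\<And>i f g h. \<lbrakk>i \<in> I; f \<in> carrier G; g \<in> carrier G; h \<in> carrier G;
        le i f g; le i g h\<rbrakk> \<Longrightarrow> le i f h"
    and left: "\<And>i f g h. \<lbrakk>i \<in> I; f \<in> carrier G; g \<in> carrier G; h \<in> carrier G;
        le i g h\<rbrakk> \<Longrightarrow> le i (f \<otimes> g) (f \<otimes> h)"
    and separating: "\<And>g h. \<lbrakk>g \<in> carrier G; h \<in> carrier G;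
        \<And>i. i \<in> I \<Longrightarrow> le i g h \<and> le i h g\<rbrakk> \<Longrightarrow> g = h"
  shows "left_orderable G"
proof -
  interpret group G by fact
  obtain r :: "'i rel" where r: "well_order_on UNIV r"
    using well_order_on by blast
  define W where "W = r - Id"
  have wf: "wf W" and W_total: "\<And>i j. i \<noteq> j \<Longrightarrow> (i, j) \<in> W \<or> (j, i) \<in> W"
    using r by (auto simp: W_def order_on_defs total_on_def)
  have left_iff: "le i (f \<otimes> g) (f \<otimes> h) \<longleftrightarrow> le i g h"
    if "i \<in> I" "f \<in> carrier G" "g \<in> carrier G" "h \<in> carrier G" for i f g h
    using left[of i f g h] left[of i "inv f" "f \<otimes> g" "f \<otimes> h"] that
    by (auto simp: m_assoc[symmetric])
  define lt where "lt g h \<longleftrightarrow> (\<exists>i\<in>I. \<not> le i h g \<and>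
      (\<forall>j\<in>I. (j, i) \<in> W \<longrightarrow> le j g h \<and> le j h g))" for g h
  have lt_left: "lt (f \<otimes> g) (f \<otimes> h) \<longleftrightarrow> lt g h"
    if "f \<in> carrier G" "g \<in> carrier G" "h \<in> carrier G" for f g h
    using that left_iff unfolding lt_def by auto
  have lt_total: "lt g h \<or> lt h g" if "g \<in> carrier G" "h \<in> carrier G" "g \<noteq> h" for g h
  proof -
    let ?D = "{i \<in> I. \<not> (le i g h \<and> le i h g)}"
    have "?D \<noteq> {}" using separating that by blast
    with wf have "\<exists>i\<in>?D. \<forall>j. (j, i) \<in> W \<longrightarrow> j \<notin> ?D"
      by (rule wfE_min') blast
    then obtain i where i: "i \<in> ?D" "\<And>j. (j, i) \<in> W \<Longrightarrow> j \<notin> ?D"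
      by blast
    have below: "\<forall>j\<in>I. (j, i) \<in> W \<longrightarrow> le j g h \<and> le j h g"
      using i(2) by blast
    from i(1) consider "i \<in> I" "\<not> le i h g" | "i \<in> I" "\<not> le i g h" by blast
    then show ?thesis using below unfolding lt_def by cases blast+
  qed
  have lt_trans: "lt f h" if fgh: "f \<in> carrier G" "g \<in> carrier G" "h \<in> carrier G"
    and "lt f g" "lt g h" for f g h
  proof -
    obtain i where i: "i \<in> I" "\<not> le i g f" "\<And>j. j \<in> I \<Longrightarrow> (j, i) \<in> W \<Longrightarrow> le j f g \<and> le j g f"
      using \<open>lt f g\<close> unfolding lt_def by blast
    obtain k where k: "k \<in> I" "\<not> le k h g" "\<And>j. j \<in> I \<Longrightarrow> (j, k) \<in> W \<Longrightarrow> le j g h \<and> le j h g"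
      using \<open>lt g h\<close> unfolding lt_def by blast
    have W_trans: "(a, c) \<in> W" if "(a, b) \<in> W" "(b, c) \<in> W" for a b c
      using that r unfolding W_def order_on_defs by (blast dest: transD antisymD)
    \<comment> \<open>The first index separating \<open>f\<close> from \<open>h\<close> is the smaller one of \<open>i\<close> and \<open>k\<close>.\<close>
    define m where "m = (if (k, i) \<in> W then k else i)"
    have m: "m \<in> I" "m = i \<or> (m, i) \<in> W" "m = k \<or> (m, k) \<in> W" "m = i \<or> m = k"
      using i(1) k(1) W_total[of i k] by (auto simp: m_def)
    have below: "(j, i) \<in> W \<and> (j, k) \<in> W" if "(j, m) \<in> W" for j
      using that m W_trans by blast
    have "le j f h \<and> le j h f" if "j \<in> I" "(j, m) \<in> W" for j
      using i(3) k(3) below that trans fgh by meson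
    moreover have "\<not> le m h f"
    proof
      assume hf: "le m h f"
      have fg: "le m f g" using m(1,2) i total fgh by metis
      have gh: "le m g h" using m(1,3) k total fgh by metis
      have "le m h g" "le m g f" using trans m(1) fgh hf fg gh by blast+
      then show False using m(4) i(2) k(2) by auto
    qed
    ultimately show ?thesis using m(1) unfolding lt_def by blast
  qed
  have lt_irrefl: "\<not> lt g g" if "g \<in> carrier G" for g
    using total that unfolding lt_def by blast
  define R where "R = {(g, h). g \<in> carrier G \<and> h \<in> carrier G \<and> (g = h \<or> lt g h)}"
  have "linear_order_on (carrier G) R"
    unfolding order_on_defs
  proof (intro conjI)
    show "R \<subseteq> carrier G \<times> carrier G" "refl_on (carrier G) R"
      by (auto simp: R_def refl_on_def)
    show "trans R"
      by (rule transI) (auto simp: R_def intro: lt_trans)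
    show "antisym R"
      by (rule antisymI) (use lt_trans lt_irrefl in \<open>unfold R_def, blast\<close>)
    show "total_on (carrier G) R"
      using lt_total by (auto simp: R_def total_on_def)
  qed
  moreover have "(f \<otimes> g, f \<otimes> h) \<in> R" if "f \<in> carrier G" "(g, h) \<in> R" for f g h
    using that lt_left by (auto simp: R_def)
  ultimately show ?thesis
    unfolding left_orderable_def using \<open>group G\<close> by blast
qed

section \<open>Ultrafilters\<close>

definition ultrafilter :: "'a filter \<Rightarrow> bool" where
  "ultrafilter U \<longleftrightarrow> U \<noteq> bot \<and> (\<forall>P. eventually P U \<or> eventually (\<lambda>x. \<not> P x) U)"

text \<open>
  A minimal proper filter is an ultrafilter: if it does not contain the complement of a set, then
  its restriction to that set is still proper, hence is the filter itself.
\<close>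

lemma ultrafilter_below_exists:
  fixes F :: "'a filter"
  assumes "F \<noteq> bot"
  obtains U where "ultrafilter U" "U \<le> F"
proof -
  let ?A = "{G. G \<noteq> bot \<and> G \<le> F}"
  have po: "partial_order_on ?A (relation_of (\<ge>) ?A)"
    by (rule partial_order_on_relation_ofI) auto
  have "\<exists>U\<in>?A. \<forall>G\<in>?A. G \<le> U \<longrightarrow> G = U"
  proof (rule predicate_Zorn[OF po])
    fix C assume "C \<in> Chains (relation_of (\<ge>) ?A)"
    then have C: "C \<subseteq> ?A" "\<And>G H. G \<in> C \<Longrightarrow> H \<in> C \<Longrightarrow> G \<le> H \<or> H \<le> G"
      by (auto simp: Chains_def relation_of_def)
    show "\<exists>u\<in>?A. \<forall>a\<in>C. a \<ge> u"
    proof (cases "C = {}")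
      case True
      then show ?thesis using assms by auto
    next
      case False
      have "eventually P (Inf C) \<longleftrightarrow> (\<exists>G\<in>C. eventually P G)" for P
        using False
      proof (rule eventually_Inf_base)
        fix G H assume "G \<in> C" "H \<in> C"
        then show "\<exists>x\<in>C. x \<le> inf G H" using C(2) by (metis inf.absorb1 inf.absorb2 order_refl)
      qed
      then have "Inf C \<noteq> bot"
        using C(1) by (auto simp: trivial_limit_def)
      moreover have "Inf C \<le> F"
        using False C(1) by (auto intro: Inf_lower2)
      ultimately show ?thesis by (auto intro: Inf_lower)
    qed
  qed
  then obtain U where U: "U \<noteq> bot" "U \<le> F"
    and minimal: "\<And>G. G \<noteq> bot \<Longrightarrow> G \<le> U \<Longrightarrow> G = U"
    by (auto dest: order_trans)
  have "eventually P U" if "\<not> eventually (\<lambda>x. \<not> P x) U" for P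
  proof -
    have "inf U (principal {x. P x}) \<noteq> bot"
      using that by (simp add: trivial_limit_def eventually_inf_principal)
    then have restrict: "inf U (principal {x. P x}) = U"
      using minimal by simp
    have "eventually P (inf U (principal {x. P x}))"
      by (simp add: eventually_inf_principal)
    then show ?thesis by (simp only: restrict)
  qed
  with U that show thesis unfolding ultrafilter_def by blast
qed

section \<open>Comparing functions along an ultrafilter up to a bounded error\<close>

definition coarse_le :: "'a filter \<Rightarrow> ('a \<Rightarrow> real) \<Rightarrow> ('a \<Rightarrow> real) \<Rightarrow> bool" where
  "coarse_le F f g \<longleftrightarrow> (\<exists>B. eventually (\<lambda>x. f x \<le> g x + B) F)"

lemma coarse_le_trans:
  assumes "coarse_le F f g" "coarse_le F g h"
  shows "coarse_le F f h"
proof -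
  obtain B C where "eventually (\<lambda>x. f x \<le> g x + B) F" "eventually (\<lambda>x. g x \<le> h x + C) F"
    using assms by (auto simp: coarse_le_def)
  then have "eventually (\<lambda>x. f x \<le> h x + (B + C)) F"
    by eventually_elim simp
  then show ?thesis by (auto simp: coarse_le_def)
qed

lemma coarse_le_total:
  assumes "ultrafilter U"
  shows "coarse_le U f g \<or> coarse_le U g f"
proof -
  have "eventually (\<lambda>x. f x \<le> g x + 0) U \<or> eventually (\<lambda>x. \<not> f x \<le> g x + 0) U"
    using assms unfolding ultrafilter_def by blast
  moreover have "eventually (\<lambda>x. g x \<le> f x + 0) U" if "eventually (\<lambda>x. \<not> f x \<le> g x + 0) U"
    using that by eventually_elim simp
  ultimately show ?thesis unfolding coarse_le_def by blast
qed

lemma qi_rel_imp_coarse_le: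
  fixes X :: "real set"
  assumes "(f, g) \<in> qi_rel X" and X: "eventually (\<lambda>x. x \<in> X) F"
  shows "coarse_le F f g"
proof -
  obtain B where B: "\<And>x. x \<in> X \<Longrightarrow> dist (f x) (g x) \<le> B"
    using assms(1) by (rule qi_relE) auto
  have "eventually (\<lambda>x. f x \<le> g x + B) F"
    using X by eventually_elim (use B in \<open>force simp: dist_real_def\<close>)
  then show ?thesis by (auto simp: coarse_le_def)
qed

text \<open>
  If \<open>f\<close> and \<open>g\<close> are not at bounded distance, the parts of \<open>X\<close> where \<open>\<bar>f - g\<bar>\<close> exceeds a given
  constant generate a proper filter; an ultrafilter containing it sees \<open>f\<close> and \<open>g\<close> drift apart.
\<close>

lemma coarse_le_separates:
  fixes f g :: "'a \<Rightarrow> real"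
  assumes eq: "\<And>U. ultrafilter U \<Longrightarrow> eventually (\<lambda>x. x \<in> X) U \<Longrightarrow>
      coarse_le U f g \<and> coarse_le U g f"
  shows "bdd_above ((\<lambda>x. dist (f x) (g x)) ` X)"
proof (rule ccontr)
  assume unbounded: "\<not> bdd_above ((\<lambda>x. dist (f x) (g x)) ` X)"
  define F where "F = inf (filtercomap (\<lambda>x. dist (f x) (g x)) at_top) (principal X)"
  have ev_F: "eventually P F \<longleftrightarrow> (\<exists>B. \<forall>x. dist (f x) (g x) \<ge> B \<longrightarrow> x \<in> X \<longrightarrow> P x)" for P
    by (simp add: F_def eventually_inf_principal eventually_filtercomap_at_top_linorder)
  have "\<exists>x\<in>X. dist (f x) (g x) \<ge> B" for B
    using unbounded by (force simp: bdd_above_def not_le intro: less_imp_le)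
  then have "F \<noteq> bot"
    by (auto simp: trivial_limit_def ev_F)
  then obtain U where U: "ultrafilter U" "U \<le> F"
    by (rule ultrafilter_below_exists)
  have "eventually (\<lambda>x. x \<in> X) U"
    using U(2) by (rule filter_leD) (simp add: ev_F)
  then obtain B C where "eventually (\<lambda>x. f x \<le> g x + B) U" "eventually (\<lambda>x. g x \<le> f x + C) U"
    using eq[OF U(1)] by (auto simp: coarse_le_def)
  moreover have "eventually (\<lambda>x. dist (f x) (g x) \<ge> max B C + 1) U"
    using U(2) by (rule filter_leD) (auto simp: ev_F)
  ultimately have "eventually (\<lambda>x. False) U"
    by eventually_elim (auto simp: dist_real_def abs_if split: if_splits)
  then show False
    using U(1) by (simp add: ultrafilter_def trivial_limit_def)
qed

section \<open>Quasi-isometries that tend to infinity are coarsely increasing\<close>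

text \<open>
  A coarse intermediate value argument. Suppose \<open>x \<le> y\<close> but \<open>f x > f y\<close>. Walking from \<open>y\<close> to the right
  in unit steps, \<open>f\<close> moves by at most \<open>K + C\<close> per step and eventually gets above \<open>f x\<close>, so it passes
  within \<open>K + C\<close> of \<open>f x\<close> at some point \<open>z \<ge> y\<close>. Then \<open>z\<close> is close to \<open>x\<close>, hence so is \<open>y\<close>, which lies
  between them, and \<open>f x\<close> exceeds \<open>f y\<close> by a bounded amount only.
\<close>

lemma quasi_isometry_coarsely_increasing:
  fixes X :: "real set"
  assumes up: "\<forall>x\<in>X. {x..} \<subseteq> X"
    and f: "f \<in> quasi_isometries X" "filterlim f at_top at_top"
  obtains D where "\<And>x y. x \<in> X \<Longrightarrow> y \<in> X \<Longrightarrow> x \<le> y + B \<Longrightarrow> f x \<le> f y + D"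
proof -
  obtain K C where K: "K \<ge> 1" "C \<ge> 0"
    and lo: "\<And>x y. x \<in> X \<Longrightarrow> y \<in> X \<Longrightarrow> dist x y \<le> K * dist (f x) (f y) + C"
    and hi: "\<And>x y. x \<in> X \<Longrightarrow> y \<in> X \<Longrightarrow> dist (f x) (f y) \<le> K * dist x y + C"
    using quasi_isometriesE[OF f(1)] by metis
  define M where "M = K * (K + C) + C"
  have step: "f x \<le> f y + (K * M + C)" if xy: "x \<in> X" "y \<in> X" "x \<le> y" for x y
  proof -
    have walk: "y + real n \<in> X" for n by (rule subsetD[OF bspec[OF up xy(2)]]) simp
    have "filterlim (\<lambda>n. f (y + real n)) at_top sequentially"
      by (intro filterlim_compose[OF f(2)] filterlim_tendsto_add_at_top[OF tendsto_const]
          filterlim_real_sequentially)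
    then have "\<exists>n. f x \<le> f (y + real n)"
      unfolding filterlim_at_top eventually_sequentially by blast
    then obtain n where n: "f x \<le> f (y + real n)" "\<And>k. k < n \<Longrightarrow> \<not> f x \<le> f (y + real k)"
      using exists_least_iff[of "\<lambda>n. f x \<le> f (y + real n)"] by blast
    show ?thesis
    proof (cases n)
      case 0
      then show ?thesis using n(1) K by (simp add: M_def add_increasing2)
    next
      case (Suc k)
      let ?z = "y + real n"
      have "f (y + real k) < f x" using n(2)[of k] Suc by simp
      moreover have "dist (f ?z) (f (y + real k)) \<le> K + C"
        using hi[OF walk walk, of n k] Suc by (simp add: dist_real_def)
      ultimately have "dist (f ?z) (f x) \<le> K + C"
        using n(1) by (simp add: dist_real_def)
      then have "K * dist (f ?z) (f x) \<le> K * (K + C)"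
        using K(1) by (intro mult_left_mono) auto
      then have "dist ?z x \<le> M"
        using lo[OF walk xy(1), of n] by (simp add: M_def)
      then have "dist x y \<le> M" using xy(3) by (simp add: dist_real_def)
      then have "K * dist x y \<le> K * M" using K(1) by (intro mult_left_mono) auto
      then show ?thesis using hi[OF xy(1,2)] by (simp add: dist_real_def)
    qed
  qed
  have "f x \<le> f y + (K * \<bar>B\<bar> + C + (K * M + C))" if xy: "x \<in> X" "y \<in> X" "x \<le> y + B" for x y
  proof -
    have y': "y + \<bar>B\<bar> \<in> X" by (rule subsetD[OF bspec[OF up xy(2)]]) simp
    have "f x \<le> f (y + \<bar>B\<bar>) + (K * M + C)" using step[OF xy(1) y'] xy(3) by simp
    moreover have "f (y + \<bar>B\<bar>) \<le> f y + (K * \<bar>B\<bar> + C)"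
      using hi[OF y' xy(2)] by (simp add: dist_real_def)
    ultimately show ?thesis by simp
  qed
  then show thesis by (rule that)
qed

lemma coarse_le_comp_left:
  fixes X :: "real set"
  assumes up: "\<forall>x\<in>X. {x..} \<subseteq> X"
    and h: "h \<in> quasi_isometries X" "filterlim h at_top at_top"
    and fg: "f \<in> X \<rightarrow> X" "g \<in> X \<rightarrow> X"
    and X: "eventually (\<lambda>x. x \<in> X) F" and le: "coarse_le F f g"
  shows "coarse_le F (h \<circ> f) (h \<circ> g)"
proof -
  obtain B where B: "eventually (\<lambda>x. f x \<le> g x + B) F"
    using le by (auto simp: coarse_le_def)
  obtain D where D: "\<And>x y. x \<in> X \<Longrightarrow> y \<in> X \<Longrightarrow> x \<le> y + B \<Longrightarrow> h x \<le> h y + D"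
    using quasi_isometry_coarsely_increasing[OF up h] by blast
  have "eventually (\<lambda>x. (h \<circ> f) x \<le> (h \<circ> g) x + D) F"
    using B X by eventually_elim (use fg D in auto)
  then show ?thesis by (auto simp: coarse_le_def)
qed

text \<open>
  On the ray, \<open>\<bar>f x - f 0\<bar>\<close> tends to infinity and \<open>f\<close> is bounded below.
\<close>

lemma quasi_isometry_ray_at_top:
  fixes f :: "real \<Rightarrow> real"
  assumes "f \<in> quasi_isometries {0..}"
  shows "filterlim f at_top at_top"
proof -
  obtain K C where K: "K \<ge> 1" and f: "f \<in> {0..} \<rightarrow> {0..}"
    and lo: "\<And>x y. x \<in> {0..} \<Longrightarrow> y \<in> {0..} \<Longrightarrow> dist x y \<le> K * dist (f x) (f y) + C"
    using quasi_isometriesE[OF assms] by metis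
  have "Z \<le> f x" if x: "x \<ge> max 0 (K * (Z + f 0) + C)" for x Z
  proof -
    have "f x \<ge> 0" "f 0 \<ge> 0" using f x by auto
    then have "K * dist (f x) (f 0) \<le> K * (f x + f 0)"
      using K by (intro mult_left_mono) (auto simp: dist_real_def)
    then have "K * (Z + f 0) \<le> K * (f x + f 0)"
      using lo[of x 0] x by (simp add: dist_real_def)
    then show ?thesis using K by simp
  qed
  then show ?thesis
    unfolding filterlim_at_top eventually_at_top_linorder by blast
qed

section \<open>Left-orderability\<close>

text \<open>
  The preorders to combine are the comparisons of representatives along the ultrafilters that
  contain \<open>X\<close>; outside \<open>X\<close> the values of a representative are arbitrary.
\<close>

lemma left_orderable_QI_subgroup:
  fixes X :: "real set"
  assumes up: "\<forall>x\<in>X. {x..} \<subseteq> X"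
    and H: "subgroup H (QI X)"
    and top: "\<And>f. f \<in> quasi_isometries X \<Longrightarrow> qi_class X f \<in> H \<Longrightarrow> filterlim f at_top at_top"
  shows "left_orderable (QI X\<lparr>carrier := H\<rparr>)"
proof -
  define le where "le U a b \<longleftrightarrow> (\<exists>f\<in>a. \<exists>g\<in>b. coarse_le U f g)" for U :: "real filter" and a b
  let ?I = "{U. ultrafilter U \<and> eventually (\<lambda>x. x \<in> X) U}"
  have le_class: "le U (qi_class X f) (qi_class X g) \<longleftrightarrow> coarse_le U f g"
    if "U \<in> ?I" "f \<in> quasi_isometries X" "g \<in> quasi_isometries X" for U f g
  proof
    assume "coarse_le U f g"
    moreover have "f \<in> qi_class X f" "g \<in> qi_class X g"
      using that equiv_class_self[OF equiv_qi_rel] by (auto simp: qi_class_def)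
    ultimately show "le U (qi_class X f) (qi_class X g)" unfolding le_def by blast
  next
    assume "le U (qi_class X f) (qi_class X g)"
    then obtain f' g' where "(f, f') \<in> qi_rel X" "(g, g') \<in> qi_rel X" "coarse_le U f' g'"
      by (auto simp: le_def qi_class_def)
    moreover from this have "(g', g) \<in> qi_rel X"
      using equiv_qi_rel[of X] by (meson equivE symD)
    ultimately show "coarse_le U f g"
      using that(1) by (blast intro: qi_rel_imp_coarse_le coarse_le_trans)
  qed
  have rep: thesis if "a \<in> H" "\<And>f. \<lbrakk>f \<in> quasi_isometries X; a = qi_class X f\<rbrakk> \<Longrightarrow> thesis"
    for a thesis
    using that subgroup.subset[OF H] by (auto simp: carrier_QI)
  have maps: "f \<in> X \<rightarrow> X" if "f \<in> quasi_isometries X" for f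
    using that by (rule quasi_isometriesE)
  have restrict: "carrier (QI X\<lparr>carrier := H\<rparr>) = H"
    "a \<otimes>\<^bsub>QI X\<lparr>carrier := H\<rparr>\<^esub> b = a \<otimes>\<^bsub>QI X\<^esub> b" for a b
    by simp_all
  show ?thesis
  proof (rule left_orderable_lexicographic[where le = le and I = ?I], simp_all only: restrict)
    show "group (QI X\<lparr>carrier := H\<rparr>)"
      using group.subgroup_imp_group[OF group_QI H] .
  next
    fix U a b assume "U \<in> ?I" and ab: "a \<in> H" "b \<in> H"
    obtain f where f: "f \<in> quasi_isometries X" "a = qi_class X f" by (rule rep[OF ab(1)])
    obtain g where g: "g \<in> quasi_isometries X" "b = qi_class X g" by (rule rep[OF ab(2)])
    show "le U a b \<or> le U b a"
      using coarse_le_total[of U f g] \<open>U \<in> ?I\<close> f g by (simp add: le_class)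
  next
    fix U a b c assume U: "U \<in> ?I" and abc: "a \<in> H" "b \<in> H" "c \<in> H"
      and le: "le U a b" "le U b c"
    obtain f where f: "f \<in> quasi_isometries X" "a = qi_class X f" by (rule rep[OF abc(1)])
    obtain g where g: "g \<in> quasi_isometries X" "b = qi_class X g" by (rule rep[OF abc(2)])
    obtain h where h: "h \<in> quasi_isometries X" "c = qi_class X h" by (rule rep[OF abc(3)])
    show "le U a c"
      using coarse_le_trans[of U f g h] le U f g h by (simp add: le_class)
  next
    fix U a b c assume U: "U \<in> ?I" and abc: "a \<in> H" "b \<in> H" "c \<in> H" and le: "le U b c"
    obtain h where h: "h \<in> quasi_isometries X" "a = qi_class X h" by (rule rep[OF abc(1)])
    obtain f where f: "f \<in> quasi_isometries X" "b = qi_class X f" by (rule rep[OF abc(2)])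
    obtain g where g: "g \<in> quasi_isometries X" "c = qi_class X g" by (rule rep[OF abc(3)])
    have "filterlim h at_top at_top" using top h abc(1) by simp
    moreover have "coarse_le U f g" using le U f g by (simp add: le_class)
    ultimately have "coarse_le U (h \<circ> f) (h \<circ> g)"
      using U by (intro coarse_le_comp_left[OF up h(1)] maps f(1) g(1)) auto
    then show "le U (a \<otimes>\<^bsub>QI X\<^esub> b) (a \<otimes>\<^bsub>QI X\<^esub> c)"
      using U h f g by (simp add: QI_mult_class le_class quasi_isometries_comp)
  next
    fix a b assume ab: "a \<in> H" "b \<in> H" and eq: "\<And>U. U \<in> ?I \<Longrightarrow> le U a b \<and> le U b a"
    obtain f where f: "f \<in> quasi_isometries X" "a = qi_class X f" by (rule rep[OF ab(1)])
    obtain g where g: "g \<in> quasi_isometries X" "b = qi_class X g" by (rule rep[OF ab(2)])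
    have "coarse_le U f g \<and> coarse_le U g f" if "U \<in> ?I" for U
      using eq[OF that] that f g by (simp add: le_class)
    then have "bdd_above ((\<lambda>x. dist (f x) (g x)) ` X)"
      by (intro coarse_le_separates) simp
    then show "a = b" using f g by (simp add: qi_class_eq_iff)
  qed
qed

theorem theorem1p2:
  shows "left_orderable QI_plus \<and> left_orderable (QI {0::real..})"
proof
  have "filterlim f at_top at_top"
    if f: "f \<in> quasi_isometries UNIV" "qi_class UNIV f \<in> carrier QI_plus" for f
  proof -
    obtain g where g: "g \<in> quasi_isometries UNIV" "orientation_preserving g"
      "qi_class UNIV g = qi_class UNIV f"
      using f(2) by (auto simp: QI_plus_def)
    then have "(g, f) \<in> qi_rel UNIV"
      using f(1) by (simp add: qi_rel_def qi_class_eq_iff)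
    then show ?thesis
      using orientation_preserving_cong g(2) by (auto simp: orientation_preserving_def)
  qed
  then have "left_orderable (QI UNIV\<lparr>carrier := carrier QI_plus\<rparr>)"
    by (intro left_orderable_QI_subgroup subgroup_QI_plus) auto
  then show "left_orderable QI_plus" by (simp add: QI_plus_def)
next
  have "left_orderable (QI {0::real..}\<lparr>carrier := carrier (QI {0..})\<rparr>)"
    by (intro left_orderable_QI_subgroup group.subgroup_self group_QI quasi_isometry_ray_at_top) auto
  then show "left_orderable (QI {0::real..})" by simp
qed

end
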